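(* Let $\mathcal{R}$ be an associative ring with unit $1\neq 0$, let $a,x\in\mathcal{R}$ and let $p,q\in\mathcal{R}$ be idempotents. Then the following statements are equivalent: (1) $x$ is the Djordjevi\'{c}-Wei $(p,q)$ inverse of $a$. (2) $a(1-p)\mathcal{R}\subseteq q\mathcal{R}$, $xap=p$, $1-q=ax$, and $xq=0$. (3) $\mathcal{R}qa\subseteq\mathcal{R}(1-p)$, $p=xa$, $px=x$, and $(1-q)ax=1-q$. (4) $x\in a\{2\}$; [$xa\mathcal{R}\subseteq p\mathcal{R}$ and ${\rm rann}(xa)\subseteq{\rm rann}(p)$] (or, as an alternative to this bracket, [$p\mathcal{R}\subseteq xa\mathcal{R}$ and ${\rm rann}(p)\subseteq{\rm rann}(xa)$]); and [$ax\mathcal{R}\subseteq{\rm rann}(q)$ and ${\rm rann}(ax)\subseteq q\mathcal{R}$] (or, as an alternative to this bracket, [${\rm rann}(q)\subseteq ax\mathcal{R}$ and $q\mathcal{R}\subseteq{\rm rann}(ax)$]). Moreover, if the Djordjevi\'{c}-Wei $(p,q)$ inverse of $a$ exists, then ${\rm rann}(p)=\varphi_a^{-1}(q\mathcal{R})$ and $\mathcal{R}q={}_a\varphi^{-1}({\rm lann}(p))$.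
   Context: For $a\in\mathcal{R}$ and idempotents $p=p^2$, $q=q^2$ in $\mathcal{R}$, $x\in\mathcal{R}$ is the Djordjevi\'{c}-Wei $(p,q)$ inverse of $a$ (denoted $a^{(2)}_{p,q}$) if $xax=x$, $xa=p$ and $ax=1-q$. Notation: $a\{2\}=\{x\in\mathcal{R}:xax=x\}$, $a\mathcal{R}=\{ar:r\in\mathcal{R}\}$, $\mathcal{R}a=\{ra:r\in\mathcal{R}\}$, ${\rm rann}(a)=\{r\in\mathcal{R}:ar=0\}$, ${\rm lann}(a)=\{r\in\mathcal{R}:ra=0\}$; $\varphi_a(r)=ar$ and ${}_a\varphi(r)=ra$ for $r\in\mathcal{R}$, and $\varphi_a^{-1}(\cdot)$, ${}_a\varphi^{-1}(\cdot)$ denote preimages. *)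

theory Defs
  imports Main
begin

text \<open>The ring is the carrier of a type of class \<open>ring_1\<close>, i.e. an associative, not necessarily
  commutative, unital ring with \<open>0 \<noteq> 1\<close>.\<close>

definition right_ideal_of :: "'a::ring_1 \<Rightarrow> 'a set" where
  "right_ideal_of a = {a * r | r. True}"

definition left_ideal_of :: "'a::ring_1 \<Rightarrow> 'a set" where
  "left_ideal_of a = {r * a | r. True}"

definition rann :: "'a::ring_1 \<Rightarrow> 'a set" where
  "rann a = {r. a * r = 0}"

definition lann :: "'a::ring_1 \<Rightarrow> 'a set" where
  "lann a = {r. r * a = 0}"

text \<open>The set \<open>a{2}\<close>.\<close>

definition outer_inverses :: "'a::ring_1 \<Rightarrow> 'a set" where
  "outer_inverses a = {x. x * a * x = x}"

text \<open>The maps \<open>\<phi>\<^sub>a\<close> (multiplication by \<open>a\<close> on the left) and \<open>\<^sub>a\<phi>\<close>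
  (multiplication by \<open>a\<close> on the right).\<close>

definition phi_left :: "'a::ring_1 \<Rightarrow> 'a \<Rightarrow> 'a" where
  "phi_left a r = a * r"

definition phi_right :: "'a::ring_1 \<Rightarrow> 'a \<Rightarrow> 'a" where
  "phi_right a r = r * a"

text \<open>\<open>x\<close> is the Djordjevic-Wei \<open>(p,q)\<close> inverse of \<open>a\<close>; the notion is meant for idempotent
  \<open>p\<close> and \<open>q\<close>, which is assumed where it is used.\<close>

definition is_DW_inverse :: "'a::ring_1 \<Rightarrow> 'a \<Rightarrow> 'a \<Rightarrow> 'a \<Rightarrow> bool" where
  "is_DW_inverse a p q x \<longleftrightarrow> x * a * x = x \<and> x * a = p \<and> a * x = 1 - q"

end

theory Submission
  imports Defs
begin

text \<open>
  Inclusions between the ideals and annihilators of idempotents are one-sided absorption laws. If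
  \<open>f\<close> is idempotent, then \<open>bR \<subseteq> fR\<close> says \<open>fb = b\<close> (lemma \<open>right_ideal_of_subset_iff\<close>), and dually
  \<open>Rb \<subseteq> Rf\<close> says \<open>bf = b\<close>; if \<open>e\<close> is idempotent, then \<open>rann e \<subseteq> rann f\<close> says \<open>fe = f\<close>
  (lemma \<open>rann_subset_iff\<close>). Hence \<open>eR \<subseteq> fR\<close> and \<open>rann e \<subseteq> rann f\<close> together squeeze
  \<open>e = fe = f\<close>: an idempotent is determined by one inclusion for its image and one, in the same
  direction, for its kernel (lemma \<open>idempotent_eq_iff\<close>).

  For an outer inverse \<open>x\<close> of \<open>a\<close>, both \<open>xa\<close> and \<open>ax\<close> are idempotent, so each bracket of ideal
  inclusions is this criterion applied to the pair \<open>xa\<close>, \<open>p\<close> or to the pair \<open>ax\<close>, \<open>1 - q\<close>. The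
  second pair fits because complementary idempotents exchange kernel and image:
  \<open>rann q = (1 - q)R\<close> and \<open>qR = rann (1 - q)\<close>.

  The inclusion \<open>a(1 - p)R \<subseteq> qR\<close> reads \<open>qa(1 - p) = a(1 - p)\<close>; multiplied by \<open>x\<close> on the left, where
  \<open>xq = 0\<close>, it gives \<open>xa = xap = p\<close>. The inclusion \<open>Rqa \<subseteq> R(1 - p)\<close> reads \<open>qap = 0\<close>; multiplied by
  \<open>x = px\<close> on the right, it gives \<open>qax = 0\<close>, so \<open>ax = (1 - q)ax = 1 - q\<close>.

  Finally, \<open>xar\<close> and \<open>axar\<close> vanish together because \<open>x = xax\<close>. Therefore \<open>pr = 0\<close> is equivalent to
  \<open>(1 - q)ar = 0\<close>, that is, to \<open>ar \<in> qR\<close>; the description of \<open>Rq\<close> is the mirror image.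
\<close>

section \<open>Ideals and annihilators of idempotents\<close>

lemma mem_right_ideal_of_iff:
  fixes f r :: "'a::ring_1"
  assumes "f * f = f"
  shows "r \<in> right_ideal_of f \<longleftrightarrow> f * r = r"
proof
  assume "r \<in> right_ideal_of f"
  then obtain s where "r = f * s"
    by (auto simp: right_ideal_of_def)
  then show "f * r = r"
    by (simp add: mult.assoc[symmetric] assms)
next
  assume "f * r = r"
  then show "r \<in> right_ideal_of f"
    unfolding right_ideal_of_def by (intro CollectI exI[of _ r]) simp
qed

lemma mem_left_ideal_of_iff:
  fixes f r :: "'a::ring_1"
  assumes "f * f = f"
  shows "r \<in> left_ideal_of f \<longleftrightarrow> r * f = r"
proof
  assume "r \<in> left_ideal_of f"
  then obtain s where "r = s * f"
    by (auto simp: left_ideal_of_def)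
  then show "r * f = r"
    by (simp add: mult.assoc assms)
next
  assume "r * f = r"
  then show "r \<in> left_ideal_of f"
    unfolding left_ideal_of_def by (intro CollectI exI[of _ r]) simp
qed

lemma right_ideal_of_subset_iff:
  fixes b f :: "'a::ring_1"
  assumes "f * f = f"
  shows "right_ideal_of b \<subseteq> right_ideal_of f \<longleftrightarrow> f * b = b"
proof
  assume sub: "right_ideal_of b \<subseteq> right_ideal_of f"
  have "b * 1 \<in> right_ideal_of b"
    unfolding right_ideal_of_def by blast
  then show "f * b = b"
    using sub mem_right_ideal_of_iff[OF assms] by auto
next
  assume "f * b = b"
  then have "f * (b * r) = b * r" for r
    by (simp add: mult.assoc[symmetric])
  then show "right_ideal_of b \<subseteq> right_ideal_of f"
    by (auto simp: mem_right_ideal_of_iff[OF assms] right_ideal_of_def[of b])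
qed

lemma left_ideal_of_subset_iff:
  fixes b f :: "'a::ring_1"
  assumes "f * f = f"
  shows "left_ideal_of b \<subseteq> left_ideal_of f \<longleftrightarrow> b * f = b"
proof
  assume sub: "left_ideal_of b \<subseteq> left_ideal_of f"
  have "1 * b \<in> left_ideal_of b"
    unfolding left_ideal_of_def by blast
  then show "b * f = b"
    using sub mem_left_ideal_of_iff[OF assms] by auto
next
  assume "b * f = b"
  then show "left_ideal_of b \<subseteq> left_ideal_of f"
    by (auto simp: mem_left_ideal_of_iff[OF assms] left_ideal_of_def[of b] mult.assoc)
qed

text \<open>The kernel of an idempotent \<open>e\<close> contains \<open>1 - e\<close> and is generated by it, so the inclusion
  need only be tested on this one element.\<close>

lemma rann_subset_iff:
  fixes e c :: "'a::ring_1"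
  assumes "e * e = e"
  shows "rann e \<subseteq> rann c \<longleftrightarrow> c * e = c"
proof
  assume sub: "rann e \<subseteq> rann c"
  have "1 - e \<in> rann e"
    by (simp add: rann_def right_diff_distrib assms)
  then have "c * (1 - e) = 0"
    using sub by (auto simp: rann_def)
  then show "c * e = c"
    by (simp add: right_diff_distrib)
next
  assume ce: "c * e = c"
  show "rann e \<subseteq> rann c"
  proof
    fix r
    assume "r \<in> rann e"
    then have "c * (e * r) = 0"
      by (simp add: rann_def)
    then show "r \<in> rann c"
      by (simp add: rann_def mult.assoc[symmetric] ce)
  qed
qed

text \<open>The two inclusions mean \<open>fe = e\<close> and \<open>fe = f\<close>.\<close>

lemma idempotent_eq_iff:
  fixes e f :: "'a::ring_1"
  assumes "e * e = e" and "f * f = f"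
  shows "right_ideal_of e \<subseteq> right_ideal_of f \<and> rann e \<subseteq> rann f \<longleftrightarrow> e = f"
  using assms by (auto simp: right_ideal_of_subset_iff rann_subset_iff)

lemma idempotent_complement:
  fixes q :: "'a::ring_1"
  assumes "q * q = q"
  shows "(1 - q) * (1 - q) = 1 - q"
  by (simp add: algebra_simps assms)

lemma rann_eq_right_ideal_of_complement:
  fixes q :: "'a::ring_1"
  assumes "q * q = q"
  shows "rann q = right_ideal_of (1 - q)"
  by (auto simp: mem_right_ideal_of_iff[OF idempotent_complement[OF assms]] rann_def
      left_diff_distrib)

lemma right_ideal_of_eq_rann_complement:
  fixes q :: "'a::ring_1"
  assumes "q * q = q"
  shows "right_ideal_of q = rann (1 - q)"
  by (auto simp: mem_right_ideal_of_iff[OF assms] rann_def left_diff_distrib)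

section \<open>Characterizations of the inverse\<close>

lemma is_DW_inverse_iff_right:
  fixes a p q x :: "'a::ring_1"
  assumes p: "p * p = p" and q: "q * q = q"
  shows "is_DW_inverse a p q x \<longleftrightarrow>
    right_ideal_of (a * (1 - p)) \<subseteq> right_ideal_of q \<and>
    x * a * p = p \<and> 1 - q = a * x \<and> x * q = 0"
proof
  assume "is_DW_inverse a p q x"
  then have xax: "x * a * x = x" and xa: "x * a = p" and ax: "a * x = 1 - q"
    by (auto simp: is_DW_inverse_def)
  have qax: "q = 1 - a * x"
    using ax by simp
  have xq: "x * q = 0"
    unfolding qax using xax by (simp add: right_diff_distrib mult.assoc)
  have "(1 - q) * (a * (1 - p)) = a * (x * a * (1 - p))"
    by (simp only: ax[symmetric] mult.assoc)
  also have "\<dots> = 0"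
    by (simp add: xa right_diff_distrib p)
  finally have "q * (a * (1 - p)) = a * (1 - p)"
    by (simp add: left_diff_distrib)
  then show "right_ideal_of (a * (1 - p)) \<subseteq> right_ideal_of q \<and>
      x * a * p = p \<and> 1 - q = a * x \<and> x * q = 0"
    by (simp add: right_ideal_of_subset_iff[OF q] xa p ax xq)
next
  assume R: "right_ideal_of (a * (1 - p)) \<subseteq> right_ideal_of q \<and>
    x * a * p = p \<and> 1 - q = a * x \<and> x * q = 0"
  then have qa: "q * (a * (1 - p)) = a * (1 - p)" and xap: "x * a * p = p"
    and ax: "a * x = 1 - q" and xq: "x * q = 0"
    by (auto simp: right_ideal_of_subset_iff[OF q])
  have "x * a * x = x"
    by (simp add: mult.assoc ax right_diff_distrib xq)
  moreover have "x * a = p"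
  proof -
    \<comment> \<open>\<open>xq = 0\<close> kills \<open>xa(1 - p)\<close>, because \<open>a(1 - p)\<close> lies in \<open>qR\<close>.\<close>
    have "x * (a * (1 - p)) = x * q * (a * (1 - p))"
      by (simp only: mult.assoc qa)
    also have "\<dots> = 0"
      by (simp add: xq)
    finally show ?thesis
      using xap by (simp add: right_diff_distrib mult.assoc[symmetric])
  qed
  ultimately show "is_DW_inverse a p q x"
    using ax by (simp add: is_DW_inverse_def)
qed

lemma is_DW_inverse_iff_left:
  fixes a p q x :: "'a::ring_1"
  assumes p: "p * p = p" and q: "q * q = q"
  shows "is_DW_inverse a p q x \<longleftrightarrow>
    left_ideal_of (q * a) \<subseteq> left_ideal_of (1 - p) \<and>
    p = x * a \<and> p * x = x \<and> (1 - q) * a * x = 1 - q"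
proof -
  have ideal: "left_ideal_of (q * a) \<subseteq> left_ideal_of (1 - p) \<longleftrightarrow> q * a * p = 0"
    by (simp add: left_ideal_of_subset_iff[OF idempotent_complement[OF p]] right_diff_distrib)
  show ?thesis
    unfolding ideal
  proof
    assume "is_DW_inverse a p q x"
    then have xax: "x * a * x = x" and xa: "x * a = p" and ax: "a * x = 1 - q"
      by (auto simp: is_DW_inverse_def)
    have "q * a * p = q * (a * x) * a"
      by (simp add: xa[symmetric] mult.assoc)
    also have "\<dots> = 0"
      by (simp add: ax right_diff_distrib q)
    finally have "q * a * p = 0" .
    moreover have "(1 - q) * a * x = 1 - q"
      by (simp add: mult.assoc ax idempotent_complement[OF q])
    ultimately show "q * a * p = 0 \<and> p = x * a \<and> p * x = x \<and> (1 - q) * a * x = 1 - q"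
      using xax xa by simp
  next
    assume L: "q * a * p = 0 \<and> p = x * a \<and> p * x = x \<and> (1 - q) * a * x = 1 - q"
    then have qap: "q * a * p = 0" and xa: "x * a = p" and px: "p * x = x"
      and sax: "(1 - q) * a * x = 1 - q"
      by blast+
    \<comment> \<open>Since \<open>x = px\<close>, the relation \<open>qap = 0\<close> already forces \<open>qax = 0\<close>.\<close>
    have "q * a * x = q * a * p * x"
      by (simp only: mult.assoc px)
    also have "\<dots> = 0"
      by (simp add: qap)
    finally have "q * a * x = 0" .
    then have "a * x = 1 - q"
      using sax by (simp add: left_diff_distrib)
    then show "is_DW_inverse a p q x"
      by (simp add: is_DW_inverse_def xa px)
  qed
qed

text \<open>Only the equations \<open>xa = p\<close> and \<open>ax = 1 - q\<close> remain to be expressed for an outer inverse, and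
  each is an equality of idempotents, to which the criterion above applies in either
  direction; \<open>P\<close> and \<open>Q\<close> range over the two choices of direction.\<close>

lemma is_DW_inverse_iff_outer:
  fixes a p q x :: "'a::ring_1"
  assumes p: "p * p = p" and q: "q * q = q"
    and P: "P \<in> {right_ideal_of (x * a) \<subseteq> right_ideal_of p \<and> rann (x * a) \<subseteq> rann p,
                 right_ideal_of p \<subseteq> right_ideal_of (x * a) \<and> rann p \<subseteq> rann (x * a)}"
    and Q: "Q \<in> {right_ideal_of (a * x) \<subseteq> rann q \<and> rann (a * x) \<subseteq> right_ideal_of q,
                 rann q \<subseteq> right_ideal_of (a * x) \<and> right_ideal_of q \<subseteq> rann (a * x)}"
  shows "is_DW_inverse a p q x \<longleftrightarrow> x \<in> outer_inverses a \<and> P \<and> Q"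
proof (cases "x * a * x = x")
  case False
  then show ?thesis
    by (simp add: is_DW_inverse_def outer_inverses_def)
next
  case xax: True
  have e: "x * a * (x * a) = x * a"
    using xax by (simp add: mult.assoc[symmetric])
  have "a * x * (a * x) = a * (x * a * x)"
    by (simp only: mult.assoc)
  then have f: "a * x * (a * x) = a * x"
    by (simp only: xax)
  note q' = idempotent_complement[OF q]
  have "P \<longleftrightarrow> x * a = p"
    using P idempotent_eq_iff[OF e p] idempotent_eq_iff[OF p e] by auto
  moreover have "Q \<longleftrightarrow> a * x = 1 - q"
    using Q idempotent_eq_iff[OF f q'] idempotent_eq_iff[OF q' f]
    unfolding rann_eq_right_ideal_of_complement[OF q] right_ideal_of_eq_rann_complement[OF q]
    by auto
  ultimately show ?thesis
    using xax by (simp add: is_DW_inverse_def outer_inverses_def)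
qed

section \<open>The annihilator of p and the left ideal of q\<close>

text \<open>Multiplication by \<open>a\<close> on the left turns \<open>yar = 0\<close> into \<open>ayar = 0\<close>, and multiplication by \<open>y\<close>
  turns it back because \<open>yay = y\<close>; so \<open>pr = 0\<close> holds exactly when \<open>(1 - q)ar = 0\<close>.\<close>

lemma rann_eq_vimage_right_ideal_of:
  fixes a p q y :: "'a::ring_1"
  assumes q: "q * q = q" and y: "is_DW_inverse a p q y"
  shows "rann p = phi_left a -` right_ideal_of q"
proof -
  have yay: "y * a * y = y" and ya: "y * a = p" and ay: "a * y = 1 - q"
    using y by (auto simp: is_DW_inverse_def)
  have "p * r = 0 \<longleftrightarrow> (1 - q) * (a * r) = 0" for r :: 'a
  proof
    assume "p * r = 0"
    then have "a * (y * a * r) = 0"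
      by (simp add: ya)
    then show "(1 - q) * (a * r) = 0"
      by (simp add: ay[symmetric] mult.assoc)
  next
    assume "(1 - q) * (a * r) = 0"
    then have "y * (a * y * (a * r)) = 0"
      by (simp add: ay)
    then have "y * a * y * a * r = 0"
      by (simp add: mult.assoc)
    then show "p * r = 0"
      by (simp only: yay) (simp only: ya)
  qed
  then show ?thesis
    unfolding right_ideal_of_eq_rann_complement[OF q]
    by (auto simp: rann_def phi_left_def)
qed

text \<open>The mirror image: \<open>rap = 0\<close> reads \<open>(ray)a = 0\<close>, which is equivalent to \<open>ray = 0\<close>, that is, to
  \<open>r(1 - q) = 0\<close>.\<close>

lemma left_ideal_of_eq_vimage_lann:
  fixes a p q y :: "'a::ring_1"
  assumes q: "q * q = q" and y: "is_DW_inverse a p q y"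
  shows "left_ideal_of q = phi_right a -` lann p"
proof -
  have yay: "y * a * y = y" and ya: "y * a = p" and ay: "a * y = 1 - q"
    using y by (auto simp: is_DW_inverse_def)
  have "r * a * p = 0 \<longleftrightarrow> r * (1 - q) = 0" for r
  proof
    assume "r * a * p = 0"
    then have "r * a * (y * a) * y = 0"
      by (simp add: ya)
    then have "r * (a * (y * a * y)) = 0"
      by (simp add: mult.assoc)
    then show "r * (1 - q) = 0"
      by (simp add: yay ay)
  next
    assume "r * (1 - q) = 0"
    then have "r * (a * y) * a = 0"
      by (simp add: ay)
    then show "r * a * p = 0"
      by (simp add: ya[symmetric] mult.assoc)
  qed
  moreover have "r * (1 - q) = 0 \<longleftrightarrow> r * q = r" for r
    by (auto simp: right_diff_distrib)
  ultimately show ?thesis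
    by (simp add: set_eq_iff mem_left_ideal_of_iff[OF q] lann_def phi_right_def)
qed

section \<open>Equivalent descriptions of the Djordjevic-Wei inverse\<close>

theorem theorem7p16:
  fixes a x p q :: "'a::ring_1"
  assumes "p = p\<^sup>2" and "q = q\<^sup>2"
  shows
    "(is_DW_inverse a p q x \<longleftrightarrow>
        right_ideal_of (a * (1 - p)) \<subseteq> right_ideal_of q \<and>
        x * a * p = p \<and> 1 - q = a * x \<and> x * q = 0) \<and>
     (is_DW_inverse a p q x \<longleftrightarrow>
        left_ideal_of (q * a) \<subseteq> left_ideal_of (1 - p) \<and>
        p = x * a \<and> p * x = x \<and> (1 - q) * a * x = 1 - q) \<and>
     (is_DW_inverse a p q x \<longleftrightarrow>
        x \<in> outer_inverses a \<and>
        (right_ideal_of (x * a) \<subseteq> right_ideal_of p \<and> rann (x * a) \<subseteq> rann p) \<and>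
        (right_ideal_of (a * x) \<subseteq> rann q \<and> rann (a * x) \<subseteq> right_ideal_of q)) \<and>
     (is_DW_inverse a p q x \<longleftrightarrow>
        x \<in> outer_inverses a \<and>
        (right_ideal_of (x * a) \<subseteq> right_ideal_of p \<and> rann (x * a) \<subseteq> rann p) \<and>
        (rann q \<subseteq> right_ideal_of (a * x) \<and> right_ideal_of q \<subseteq> rann (a * x))) \<and>
     (is_DW_inverse a p q x \<longleftrightarrow>
        x \<in> outer_inverses a \<and>
        (right_ideal_of p \<subseteq> right_ideal_of (x * a) \<and> rann p \<subseteq> rann (x * a)) \<and>
        (right_ideal_of (a * x) \<subseteq> rann q \<and> rann (a * x) \<subseteq> right_ideal_of q)) \<and>
     (is_DW_inverse a p q x \<longleftrightarrow>
        x \<in> outer_inverses a \<and>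
        (right_ideal_of p \<subseteq> right_ideal_of (x * a) \<and> rann p \<subseteq> rann (x * a)) \<and>
        (rann q \<subseteq> right_ideal_of (a * x) \<and> right_ideal_of q \<subseteq> rann (a * x))) \<and>
     ((\<exists>y. is_DW_inverse a p q y) \<longrightarrow>
        rann p = phi_left a -` right_ideal_of q \<and>
        left_ideal_of q = phi_right a -` lann p)"
proof -
  have p: "p * p = p" and q: "q * q = q"
    using assms by (simp_all add: power2_eq_square)
  have "rann p = phi_left a -` right_ideal_of q \<and> left_ideal_of q = phi_right a -` lann p"
    if "\<exists>y. is_DW_inverse a p q y"
    using that rann_eq_vimage_right_ideal_of[OF q] left_ideal_of_eq_vimage_lann[OF q] by blast
  then show ?thesis
    by (intro conjI impI is_DW_inverse_iff_right[OF p q] is_DW_inverse_iff_left[OF p q]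
        is_DW_inverse_iff_outer[OF p q]) simp_all
qed

end
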